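(* For any integers $r,s\ge 2$ and any integers $1\le k_1\le k_2\le\dots\le k_{s+1}$, we have $$sat_r(n,K_{k_1,k_2,\dots,k_{s+1}})=O(n)$$ as $n\to\infty$, where $K_{k_1,\dots,k_{s+1}}$ is the complete $(s+1)$-partite graph with class sizes $k_1,\dots,k_{s+1}$ and the implied constant may depend on $r,s,k_1,\dots,k_{s+1}$.
   Context: A hypergraph $H$ is a Berge copy of a graph $F$ (a Berge-$F$) if $V(F)\subset V(H)$ and there is a bijection $f:E(F)\to E(H)$ such that $e\subset f(e)$ for every $e\in E(F)$ (with $F$ identified with a copy of it on vertices of $H$). A hypergraph is Berge-$F$-free if it contains no Berge-$F$ as a subhypergraph. An $r$-uniform hypergraph $H$ is Berge-$F$-saturated if it is Berge-$F$-free, but adding to $H$ any $r$-subset of $V(H)$ that is not already a hyperedge creates a Berge-$F$. $sat_r(n,F)$ denotes the minimum number of hyperedges in a Berge-$F$-saturated $r$-uniform hypergraph on $n$ vertices. *)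

theory Defs
  imports "HOL-Library.Landau_Symbols"
begin

text \<open>A hypergraph is a vertex set together with a set of hyperedges (no repeated hyperedges);
  a graph is a 2-uniform hypergraph.\<close>

type_synonym 'a hypergraph = "'a set \<times> 'a set set"

abbreviation verts :: "'a hypergraph \<Rightarrow> 'a set" where
  "verts H \<equiv> fst H"

abbreviation hedges :: "'a hypergraph \<Rightarrow> 'a set set" where
  "hedges H \<equiv> snd H"

definition hypergraph :: "'a hypergraph \<Rightarrow> bool" where
  "hypergraph H \<longleftrightarrow> finite (verts H) \<and> hedges H \<subseteq> Pow (verts H)"

definition uniform_hypergraph :: "nat \<Rightarrow> 'a hypergraph \<Rightarrow> bool" where
  "uniform_hypergraph r H \<longleftrightarrow> hypergraph H \<and> (\<forall>e\<in>hedges H. card e = r)"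

definition subhypergraph :: "'a hypergraph \<Rightarrow> 'a hypergraph \<Rightarrow> bool" where
  "subhypergraph H' H \<longleftrightarrow> hypergraph H' \<and> verts H' \<subseteq> verts H \<and> hedges H' \<subseteq> hedges H"

text \<open>The injection \<open>\<phi>\<close> identifies \<open>F\<close> with a copy of it on vertices of \<open>H\<close>.\<close>

definition berge_copy :: "'b hypergraph \<Rightarrow> 'a hypergraph \<Rightarrow> bool" where
  "berge_copy F H \<longleftrightarrow>
     (\<exists>\<phi> f. inj_on \<phi> (verts F) \<and> \<phi> ` verts F \<subseteq> verts H \<and>
            bij_betw f (hedges F) (hedges H) \<and> (\<forall>e\<in>hedges F. \<phi> ` e \<subseteq> f e))"

definition berge_free :: "'b hypergraph \<Rightarrow> 'a hypergraph \<Rightarrow> bool" where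
  "berge_free F H \<longleftrightarrow> \<not> (\<exists>H'. subhypergraph H' H \<and> berge_copy F H')"

definition berge_saturated :: "nat \<Rightarrow> 'b hypergraph \<Rightarrow> 'a hypergraph \<Rightarrow> bool" where
  "berge_saturated r F H \<longleftrightarrow>
     uniform_hypergraph r H \<and> berge_free F H \<and>
     (\<forall>e. e \<subseteq> verts H \<and> card e = r \<and> e \<notin> hedges H \<longrightarrow>
          \<not> berge_free F (verts H, insert e (hedges H)))"

text \<open>Up to isomorphism, every \<open>n\<close>-vertex hypergraph has its vertices in \<^typ>\<open>nat\<close>.
  By \<open>sat_attained\<close> below, the infimum is a minimum as soon as \<open>F\<close> has an edge.\<close>

definition sat :: "nat \<Rightarrow> nat \<Rightarrow> 'b hypergraph \<Rightarrow> nat" where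
  "sat r n F =
     Inf {card (hedges H) | H :: nat hypergraph. card (verts H) = n \<and> berge_saturated r F H}"

text \<open>Vertex \<open>(i, a)\<close> is the \<open>a\<close>-th vertex of the \<open>i\<close>-th class; the classes are indexed
  by \<open>1, \<dots>, m\<close> and class \<open>i\<close> has size \<open>k i\<close>.\<close>

definition complete_multipartite :: "nat \<Rightarrow> (nat \<Rightarrow> nat) \<Rightarrow> (nat \<times> nat) hypergraph" where
  "complete_multipartite m k =
     (let V = (SIGMA i:{1..m}. {..<k i})
      in (V, {{u, v} | u v. u \<in> V \<and> v \<in> V \<and> fst u \<noteq> fst v}))"

lemma berge_saturated_exists:
  assumes "hedges F \<noteq> {}"
  shows "\<exists>H :: nat hypergraph. card (verts H) = n \<and> berge_saturated r F H"
proof -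
  define C where "C = {e :: nat set. e \<subseteq> {..<n} \<and> card e = r}"
  define P where "P = (\<lambda>E. E \<subseteq> C \<and> berge_free F ({..<n}, E))"
  have fC: "finite C" unfolding C_def by simp
  have "P {}"
    using assms unfolding P_def berge_free_def subhypergraph_def berge_copy_def bij_betw_def by auto
  moreover have "\<forall>E. P E \<longrightarrow> card E \<le> card C"
    using fC unfolding P_def by (auto intro: card_mono)
  ultimately obtain E where E: "P E" "\<And>E'. P E' \<Longrightarrow> card E' \<le> card E"
    using ex_has_greatest_nat[of P "{}" card "Suc (card C)"] by (auto simp: less_Suc_eq_le)
  have fE: "finite E" using E(1) fC finite_subset unfolding P_def by blast
  have "\<not> berge_free F ({..<n}, insert e E)" if "e \<in> C" "e \<notin> E" for e
  proof
    assume "berge_free F ({..<n}, insert e E)"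
    then have "P (insert e E)" using E(1) that unfolding P_def by auto
    from E(2)[OF this] show False using fE that by simp
  qed
  moreover have "uniform_hypergraph r ({..<n}, E)"
    using E(1) unfolding P_def C_def uniform_hypergraph_def hypergraph_def by auto
  ultimately have "berge_saturated r F ({..<n}, E)"
    using E(1) unfolding berge_saturated_def P_def C_def by auto
  then show ?thesis by (intro exI[of _ "({..<n}, E)"]) simp
qed

lemma sat_attained:
  assumes "hedges F \<noteq> {}"
  shows "\<exists>H :: nat hypergraph. card (verts H) = n \<and> berge_saturated r F H \<and>
           card (hedges H) = sat r n F"
proof -
  have "sat r n F \<in>
      {card (hedges H) | H :: nat hypergraph. card (verts H) = n \<and> berge_saturated r F H}"
    unfolding sat_def using berge_saturated_exists[OF assms, of n r] by (intro Inf_nat_def1) blast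
  then obtain H :: "nat hypergraph" where
    "sat r n F = card (hedges H)" "card (verts H) = n" "berge_saturated r F H"
    by blast
  then show ?thesis by (intro exI[of _ H]) simp
qed

lemma complete_multipartite_edges_nonempty:
  assumes "m \<ge> 2" "k 1 \<ge> 1" "k 2 \<ge> 1"
  shows "hedges (complete_multipartite m k) \<noteq> {}"
proof -
  have "{(1, 0), (2, 0)} \<in> hedges (complete_multipartite m k)"
    using assms unfolding complete_multipartite_def Let_def by fastforce
  then show ?thesis by blast
qed

end

theory Submission
  imports Defs "HOL-Library.Disjoint_Sets"
begin

text \<open>Let \<open>L\<close> be the largest class and \<open>d\<close> the number of the other vertices, so that all degrees are
  at least \<open>d\<close>. Take a core \<open>C\<close> of \<open>d - 1\<close> vertices and cut almost all other vertices into blocks of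
  size \<open>r - 1\<close>. The hyperedges are \<open>{c} \<union> B\<close> for all \<open>c \<in> C\<close> and all blocks \<open>B\<close>, and for every pair
  of core vertices one hyperedge containing it whose other \<open>r - 2\<close> vertices are private. Vertices
  outside \<open>C\<close> have degree at most \<open>d - 1\<close>, so there is no Berge copy. If further hyperedges
  contain a Berge star with \<open>card L\<close> leaves and all its vertices in different blocks, then the core
  together with the star carries a Berge copy. Hence in a Berge-free extension the new hyperedges
  through a vertex of a block essentially live on boundedly many blocks, so degrees outside a
  bounded set are bounded.\<close>

section \<open>Saturated extensions, criteria for Berge copies, disjoint subsets\<close>

text \<open>A Berge-free set of hyperedges of maximum size among those containing \<open>E0\<close>
  is saturated. Nothing else is known about that extension, so \<open>bound\<close> is demanded for
  all Berge-free extensions.\<close>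

lemma sat_le:
  fixes V :: "nat set"
  assumes V: "finite V" "card V = n"
    and E0: "E0 \<subseteq> {e. e \<subseteq> V \<and> card e = r}" "berge_free F (V, E0)"
    and bound: "\<And>E. E0 \<subseteq> E \<Longrightarrow> E \<subseteq> {e. e \<subseteq> V \<and> card e = r} \<Longrightarrow> berge_free F (V, E) \<Longrightarrow> card E \<le> b"
  shows "sat r n F \<le> b"
proof -
  define S where "S = {e. e \<subseteq> V \<and> card e = r}"
  define Q where "Q = (\<lambda>E. E0 \<subseteq> E \<and> E \<subseteq> S \<and> berge_free F (V, E))"
  have fS: "finite S" unfolding S_def using V by simp
  have "Q E0" using E0 unfolding Q_def S_def by auto
  moreover have "\<forall>E. Q E \<longrightarrow> card E \<le> card S"
    using fS unfolding Q_def by (auto intro: card_mono)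
  ultimately obtain E where E: "Q E" "\<And>E'. Q E' \<Longrightarrow> card E' \<le> card E"
    using ex_has_greatest_nat[of Q E0 card "Suc (card S)"] by (auto simp: less_Suc_eq_le)
  have fE: "finite E" using E(1) fS finite_subset unfolding Q_def by blast
  have "\<not> berge_free F (V, insert e E)" if "e \<in> S" "e \<notin> E" for e
  proof
    assume "berge_free F (V, insert e E)"
    then have "Q (insert e E)" using E(1) that unfolding Q_def by auto
    from E(2)[OF this] show False using fE that by simp
  qed
  moreover have "uniform_hypergraph r (V, E)"
    using E(1) V unfolding Q_def S_def uniform_hypergraph_def hypergraph_def by auto
  ultimately have "berge_saturated r F (V, E)"
    using E(1) unfolding berge_saturated_def Q_def S_def by auto
  then have "sat r n F \<le> card E"
    unfolding sat_def using V
    by (intro wellorder_Inf_le1) (auto intro!: exI[of _ V] exI[of _ E])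
  also have "card E \<le> b" using E(1) unfolding Q_def S_def by (intro bound) auto
  finally show ?thesis .
qed

lemma not_berge_freeI:
  assumes "finite V" "E \<subseteq> Pow V" "inj_on \<phi> (verts F)" "\<phi> ` verts F \<subseteq> V"
    and "inj_on f (hedges F)" "f ` hedges F \<subseteq> E" "\<And>e. e \<in> hedges F \<Longrightarrow> \<phi> ` e \<subseteq> f e"
  shows "\<not> berge_free F (V, E)"
proof -
  have "subhypergraph (V, f ` hedges F) (V, E)"
    using assms unfolding subhypergraph_def hypergraph_def by auto
  moreover have "berge_copy F (V, f ` hedges F)"
    using assms unfolding berge_copy_def
    by (intro exI[of _ \<phi>] exI[of _ f]) (auto intro: inj_on_imp_bij_betw)
  ultimately show ?thesis unfolding berge_free_def by blast
qed

text \<open>The edge bijection maps the edges at \<open>u\<close> injectively to hyperedges at the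
  image of \<open>u\<close>. Only this comparison of degrees is kept from the Berge copy; it is
  enough to refute one in the base hypergraph.\<close>

lemma not_berge_freeE:
  assumes "\<not> berge_free F (V, E)" "finite E"
  obtains \<phi> where "inj_on \<phi> (verts F)"
    and "\<And>u. card {e \<in> hedges F. u \<in> e} \<le> card {e \<in> E. \<phi> u \<in> e}"
proof -
  from assms obtain V' E' \<phi> f where H: "E' \<subseteq> E"
    and \<phi>: "inj_on \<phi> (verts F)" "bij_betw f (hedges F) E'" "\<And>e. e \<in> hedges F \<Longrightarrow> \<phi> ` e \<subseteq> f e"
    unfolding berge_free_def subhypergraph_def berge_copy_def by auto
  have "card {e \<in> hedges F. u \<in> e} \<le> card {e \<in> E. \<phi> u \<in> e}" for u
  proof (rule card_inj_on_le)
    show "inj_on f {e \<in> hedges F. u \<in> e}"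
      using \<phi>(2) unfolding bij_betw_def by (auto intro: inj_on_subset)
    show "f ` {e \<in> hedges F. u \<in> e} \<subseteq> {e \<in> E. \<phi> u \<in> e}"
      using \<phi>(2,3) H unfolding bij_betw_def by blast
    show "finite {e \<in> E. \<phi> u \<in> e}" using assms(2) by simp
  qed
  with \<phi>(1) show ?thesis by (rule that)
qed

lemma obtain_disjoint_subsets:
  assumes "finite I" "finite V" "card I * l \<le> card V"
  obtains P where "disjoint_family_on P I" "\<And>i. i \<in> I \<Longrightarrow> P i \<subseteq> V \<and> card (P i) = l"
proof -
  have "\<exists>P. disjoint_family_on P I \<and> (\<forall>i\<in>I. P i \<subseteq> V \<and> card (P i) = l)"
    using assms
  proof (induction I arbitrary: V rule: finite_induct)
    case empty
    then show ?case by (auto simp: disjoint_family_on_def)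
  next
    case (insert i I)
    then have le: "l + card I * l \<le> card V" by simp
    then obtain X where X: "X \<subseteq> V" "card X = l" "finite X"
      using obtain_subset_with_card_n[of l V] by auto
    have "card I * l \<le> card (V - X)"
      using le X by (simp add: card_Diff_subset)
    then obtain P where P: "disjoint_family_on P I" "\<forall>i\<in>I. P i \<subseteq> V - X \<and> card (P i) = l"
      using insert.IH[of "V - X"] insert.prems by auto
    have "disjoint_family_on (P(i := X)) (insert i I)"
      using P insert.hyps unfolding disjoint_family_on_def by (auto; blast)
    moreover have "\<forall>j\<in>insert i I. (P(i := X)) j \<subseteq> V \<and> card ((P(i := X)) j) = l"
      using P X insert.hyps by auto
    ultimately show ?case by blast
  qed
  with that show ?thesis by blast
qed

section \<open>The base hypergraph built from a core and blocks\<close>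

text \<open>\<open>C\<close> is the core, \<open>B j\<close> are the blocks, and \<open>P p\<close>
  holds the private vertices that fill up the core pair \<open>p\<close> to a hyperedge; for
  \<open>r = 2\<close> it is empty. Vertices outside all of these sets are allowed, because
  divisibility may leave some over.\<close>

locale core_blocks =
  fixes r :: nat and V C :: "'a set" and P :: "'a set \<Rightarrow> 'a set"
    and I :: "nat set" and B :: "nat \<Rightarrow> 'a set"
  assumes r: "r \<ge> 2" and fin_V: "finite V" and C: "C \<subseteq> V" "C \<noteq> {}"
    and P: "\<And>p. p \<subseteq> C \<Longrightarrow> card p = 2 \<Longrightarrow> P p \<subseteq> V - C \<and> card (P p) = r - 2"
    and disj_P: "disjoint_family_on P {p. p \<subseteq> C \<and> card p = 2}"
    and B: "\<And>j. j \<in> I \<Longrightarrow> B j \<subseteq> V - C \<and> card (B j) = r - 1"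
    and disj_B: "disjoint_family_on B I"
    and disj_PB: "\<And>p j. p \<subseteq> C \<Longrightarrow> card p = 2 \<Longrightarrow> j \<in> I \<Longrightarrow> P p \<inter> B j = {}"
begin

definition base :: "'a set set" where
  "base = {insert c (B j) | c j. c \<in> C \<and> j \<in> I} \<union> {p \<union> P p | p. p \<subseteq> C \<and> card p = 2}"

text \<open>This is the core, the private vertices and the leftover vertices together. Degrees in an
  extension are estimated only outside this set, so its size has to stay bounded.\<close>

definition rest :: "'a set" where
  "rest = V - (\<Union>j\<in>I. B j)"

lemma fin_C: "finite C"
  using C fin_V finite_subset by blast

lemma base_uniform: "base \<subseteq> {e. e \<subseteq> V \<and> card e = r}"
proof
  fix e assume "e \<in> base"
  then consider c j where "c \<in> C" "j \<in> I" "e = insert c (B j)"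
    | p where "p \<subseteq> C" "card p = 2" "e = p \<union> P p"
    unfolding base_def by blast
  then show "e \<in> {e. e \<subseteq> V \<and> card e = r}"
  proof cases
    case 1
    have "finite (B j)" using B[OF 1(2)] fin_V finite_subset by blast
    moreover have "c \<notin> B j" using B[OF 1(2)] 1 by blast
    ultimately show ?thesis using 1 B[OF 1(2)] C r by auto
  next
    case 2
    have "finite p" "finite (P p)" using P[OF 2(1,2)] 2 fin_V fin_C by (blast intro: finite_subset)+
    moreover have "p \<inter> P p = {}" using P[OF 2(1,2)] 2 by blast
    ultimately have "card e = card p + card (P p)" using 2 by (simp add: card_Un_disjoint)
    then show ?thesis using 2 P[OF 2(1,2)] C r by auto
  qed
qed

text \<open>By disjointness, \<open>v\<close> lies in at most one block or at most one private set,
  never in both. A block has one base hyperedge per core vertex; a private set has a single one, and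
  \<open>1 \<le> card C\<close> as the core is nonempty.\<close>

lemma base_degree:
  assumes "v \<notin> C"
  shows "card {e \<in> base. v \<in> e} \<le> card C"
proof -
  consider j where "j \<in> I" "v \<in> B j" | p where "p \<subseteq> C" "card p = 2" "v \<in> P p"
    | "\<forall>j\<in>I. v \<notin> B j" "\<forall>p. p \<subseteq> C \<longrightarrow> card p = 2 \<longrightarrow> v \<notin> P p"
    by blast
  then show ?thesis
  proof cases
    case 1
    have "{e \<in> base. v \<in> e} \<subseteq> (\<lambda>c. insert c (B j)) ` C"
    proof
      fix e assume e: "e \<in> {e \<in> base. v \<in> e}"
      then consider c i where "c \<in> C" "i \<in> I" "e = insert c (B i)"
        | p where "p \<subseteq> C" "card p = 2" "e = p \<union> P p"
        unfolding base_def by blast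
      then show "e \<in> (\<lambda>c. insert c (B j)) ` C"
      proof cases
        case c: 1
        then have "v \<in> B i" using e assms by auto
        then have "i = j" using 1 c disj_B unfolding disjoint_family_on_def by blast
        then show ?thesis using c by auto
      next
        case 2
        then have "v \<in> P p" using e assms by auto
        then show ?thesis using disj_PB[OF 2(1,2) 1(1)] 1 by blast
      qed
    qed
    then show ?thesis using surj_card_le[OF fin_C] by blast
  next
    case 2
    have "{e \<in> base. v \<in> e} \<subseteq> {p \<union> P p}"
    proof
      fix e assume e: "e \<in> {e \<in> base. v \<in> e}"
      then consider c i where "c \<in> C" "i \<in> I" "e = insert c (B i)"
        | p' where "p' \<subseteq> C" "card p' = 2" "e = p' \<union> P p'"
        unfolding base_def by blast
      then show "e \<in> {p \<union> P p}"
      proof cases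
        case c: 1
        then have "v \<in> B i" using e assms by auto
        then show ?thesis using disj_PB[OF 2(1,2) c(2)] 2 by blast
      next
        case c: 2
        then have "v \<in> P p'" using e assms by auto
        then have "p' = p" using 2 c disj_P unfolding disjoint_family_on_def by blast
        then show ?thesis using c by auto
      qed
    qed
    then have "card {e \<in> base. v \<in> e} \<le> 1"
      using card_mono[of "{p \<union> P p}"] by simp
    also have "1 \<le> card C" using C fin_C by (simp add: Suc_le_eq card_gt_0_iff)
    finally show ?thesis .
  next
    case 3
    then have "{e \<in> base. v \<in> e} = {}" using assms unfolding base_def by auto
    then show ?thesis by (metis card.empty le0)
  qed
qed

lemma finite_base: "finite base"
  using base_uniform fin_V by (auto intro: finite_subset[of _ "Pow V"])

text \<open>The core is too small to hold all vertices of a copy of \<open>F\<close>, and a vertex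
  placed outside it has too small a degree.\<close>

lemma base_berge_free:
  assumes "card C < card (verts F)"
    and "\<And>u. u \<in> verts F \<Longrightarrow> card C < card {e \<in> hedges F. u \<in> e}"
  shows "berge_free F (V, base)"
proof (rule ccontr)
  assume "\<not> berge_free F (V, base)"
  then obtain \<phi> where \<phi>: "inj_on \<phi> (verts F)"
    "\<And>u. card {e \<in> hedges F. u \<in> e} \<le> card {e \<in> base. \<phi> u \<in> e}"
    using not_berge_freeE finite_base by blast
  have "\<not> \<phi> ` verts F \<subseteq> C"
    using card_inj_on_le[OF \<phi>(1) _ fin_C] assms(1) by auto
  then obtain u where "u \<in> verts F" "\<phi> u \<notin> C" by blast
  then show False
    using assms(2)[of u] \<phi>(2)[of u] base_degree[of "\<phi> u"] by linarith
qed

section \<open>Berge copies from stars with vertices in different blocks\<close>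

text \<open>Contracting base hyperedges to their trace on \<open>C \<union> T\<close> makes \<open>C\<close> complete and joins it to
  the transversal \<open>T\<close>; equal traces force equal pairs, so the chosen hyperedges are distinct.\<close>

lemma base_trace:
  assumes T: "\<And>x. x \<in> T \<Longrightarrow> \<exists>j\<in>I. B j \<inter> T = {x}"
    and p: "p \<subseteq> C \<union> T" "card p = 2" "p \<inter> C \<noteq> {}"
  shows "\<exists>e\<in>base. e \<inter> (C \<union> T) = p"
proof (cases "p \<subseteq> C")
  case True
  \<comment> \<open>Every vertex of \<open>T\<close> lies in a block, and private sets avoid the
    blocks.\<close>
  have "P p \<inter> T = {}" using T disj_PB[OF True p(2)] by blast
  moreover have "P p \<inter> C = {}" using P[OF True p(2)] by blast
  ultimately have "(p \<union> P p) \<inter> (C \<union> T) = p" using True by blast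
  moreover have "p \<union> P p \<in> base" using True p unfolding base_def by blast
  ultimately show ?thesis by blast
next
  case False
  obtain c where c: "c \<in> p" "c \<in> C" using p by blast
  moreover obtain x where x: "x \<in> p" "x \<notin> C" using False by blast
  ultimately have pe: "p = {c, x}" using p(2) by (auto simp: card_2_iff)
  obtain j where j: "j \<in> I" "B j \<inter> T = {x}" using T p x by blast
  have "B j \<inter> C = {}" using B[OF j(1)] by blast
  then have "insert c (B j) \<inter> (C \<union> T) = p" using j c pe by blast
  moreover have "insert c (B j) \<in> base" using j c unfolding base_def by blast
  ultimately show ?thesis by blast
qed

text \<open>Place \<open>L\<close> on the leaves \<open>W\<close> and the other
  \<open>Suc (card C)\<close> vertices of \<open>F\<close> on \<open>C\<close> and the centre
  \<open>v\<close>. Since \<open>L\<close> is independent, every edge becomes a pair meeting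
  \<open>C\<close>, carried by a base hyperedge, or a pair of \<open>v\<close> and a leaf
  \<open>w\<close>, carried by \<open>h w\<close>.\<close>

lemma star_berge_copy:
  assumes E: "base \<subseteq> E" "E \<subseteq> Pow V"
    and F: "finite (verts F)" "\<And>e. e \<in> hedges F \<Longrightarrow> e \<subseteq> verts F \<and> card e = 2"
    and L: "L \<subseteq> verts F" "\<And>e. e \<in> hedges F \<Longrightarrow> \<not> e \<subseteq> L" "card (verts F - L) = Suc (card C)"
    and star: "v \<notin> W" "card W = card L" "finite W" "inj_on h W"
      "\<And>w. w \<in> W \<Longrightarrow> h w \<in> E - base \<and> v \<in> h w \<and> w \<in> h w"
    and T: "\<And>x. x \<in> insert v W \<Longrightarrow> \<exists>j\<in>I. B j \<inter> insert v W = {x}"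
  shows "\<not> berge_free F (V, E)"
proof -
  let ?T = "insert v W" and ?R = "verts F - L"
  have TV: "?T \<subseteq> V - C" using T B by blast
  have finL: "finite L" using L F finite_subset by blast
  have "card ?R = card (insert v C)" using L TV fin_C by simp
  then obtain \<alpha> where \<alpha>: "bij_betw \<alpha> ?R (insert v C)"
    using finite_same_card_bij[of ?R "insert v C"] F fin_C by auto
  obtain \<beta> where \<beta>: "bij_betw \<beta> L W"
    using finite_same_card_bij[of L W] finL star by auto
  define \<phi> where "\<phi> u = (if u \<in> L then \<beta> u else \<alpha> u)" for u
  have \<phi>L: "\<phi> ` L = W" using \<beta> unfolding \<phi>_def bij_betw_def by auto
  have \<phi>R: "\<phi> ` ?R = insert v C" using \<alpha> unfolding \<phi>_def bij_betw_def by auto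
  have "inj_on \<phi> L" "inj_on \<phi> ?R"
    using \<alpha> \<beta> unfolding \<phi>_def bij_betw_def by (auto simp: inj_on_def)
  moreover have "\<phi> ` (L - ?R) \<inter> \<phi> ` (?R - L) = {}"
  proof -
    have "L - ?R = L" "?R - L = ?R" by auto
    then show ?thesis using \<phi>L \<phi>R TV star(1) by auto
  qed
  ultimately have "inj_on \<phi> (L \<union> ?R)" unfolding inj_on_Un by blast
  moreover have LR: "L \<union> ?R = verts F" using L by blast
  ultimately have inj: "inj_on \<phi> (verts F)" by simp
  have im: "\<phi> ` verts F = C \<union> ?T" using \<phi>L \<phi>R LR by (metis Un_commute Un_insert_left Un_insert_right image_Un)
  \<comment> \<open>All pairs that an edge of \<open>F\<close> may be mapped to; excluding pairs
    inside \<open>W\<close> reflects the independence of \<open>L\<close>.\<close>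
  define S where "S = {p. p \<subseteq> C \<union> ?T \<and> card p = 2 \<and> \<not> p \<subseteq> W}"
  have pS: "\<phi> ` e \<in> S" if "e \<in> hedges F" for e
  proof -
    have e: "e \<subseteq> verts F" "card e = 2" "\<not> e \<subseteq> L" using F(2) L(2) that by auto
    then have "card (\<phi> ` e) = 2" using inj by (metis card_image inj_on_subset)
    moreover have "\<phi> ` e \<subseteq> C \<union> ?T" using e im by blast
    moreover obtain u where "u \<in> e" "u \<in> ?R" using e by blast
    then have "\<phi> u \<in> \<phi> ` e" "\<phi> u \<in> insert v C" using \<phi>R by blast+
    then have "\<not> \<phi> ` e \<subseteq> W" using star(1) TV by auto
    ultimately show ?thesis unfolding S_def by blast
  qed
  \<comment> \<open>\<open>g\<close> assigns a carrying hyperedge to each pair. A pair that misses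
    the core consists of \<open>v\<close> and a leaf, and \<open>the_elem (p - {v})\<close> recovers
    this leaf.\<close>
  define g where "g p = (if p \<inter> C \<noteq> {} then SOME e. e \<in> base \<and> e \<inter> (C \<union> ?T) = p
      else h (the_elem (p - {v})))" for p
  have g1: "g p \<in> base \<and> g p \<inter> (C \<union> ?T) = p" if "p \<in> S" "p \<inter> C \<noteq> {}" for p
  proof -
    have "\<exists>e. e \<in> base \<and> e \<inter> (C \<union> ?T) = p"
      using base_trace[of ?T p] T that unfolding S_def by blast
    from someI_ex[OF this] show ?thesis using that unfolding g_def by simp
  qed
  have g2: "\<exists>w\<in>W. p = {v, w} \<and> g p = h w" if "p \<in> S" "p \<inter> C = {}" for p
  proof -
    have "v \<in> p" using that unfolding S_def by blast
    moreover have "card p = 2" using that unfolding S_def by simp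
    ultimately obtain w where w: "p = {v, w}" "w \<noteq> v" by (auto simp: card_2_iff)
    then have "w \<in> W" using that unfolding S_def by auto
    moreover have "p - {v} = {w}" using w by auto
    then have "g p = h w" using that unfolding g_def by simp
    ultimately show ?thesis using w by blast
  qed
  have inj_g: "inj_on g S"
  proof (rule inj_onI)
    fix p p' assume p: "p \<in> S" "p' \<in> S" "g p = g p'"
    \<comment> \<open>Whether \<open>g q\<close> is a base hyperedge tells whether \<open>q\<close>
      meets the core, so the two kinds of carriers cannot collide.\<close>
    have nb: "q \<inter> C = {}" if "q \<in> S" "g q \<notin> base" for q using g1 that by blast
    have nb': "g q \<notin> base" if "q \<in> S" "q \<inter> C = {}" for q using g2[OF that] star(5) by auto
    show "p = p'"
    proof (cases "p \<inter> C = {}")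
      case True
      then have "p' \<inter> C = {}" using nb nb' p by metis
      then obtain w w' where "w \<in> W" "w' \<in> W" "p = {v, w}" "p' = {v, w'}" "h w = h w'"
        using g2 True p by metis
      then show ?thesis using star(4) by (auto dest: inj_onD)
    next
      case False
      then have "p' \<inter> C \<noteq> {}" using g1 nb' p by metis
      then show ?thesis using g1 False p by metis
    qed
  qed
  have g: "g p \<in> E \<and> p \<subseteq> g p" if "p \<in> S" for p
  proof (cases "p \<inter> C = {}")
    case True
    then show ?thesis using g2[OF that] star(5) by auto
  next
    case False
    then show ?thesis using g1[OF that] E by blast
  qed
  show ?thesis
  proof (rule not_berge_freeI[where \<phi> = \<phi> and f = "\<lambda>e. g (\<phi> ` e)"])
    show "finite V" "E \<subseteq> Pow V" "inj_on \<phi> (verts F)" using fin_V E inj by auto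
    show "\<phi> ` verts F \<subseteq> V" using im C TV by auto
    show "inj_on (\<lambda>e. g (\<phi> ` e)) (hedges F)"
    proof (rule inj_onI)
      fix e e' assume e: "e \<in> hedges F" "e' \<in> hedges F" "g (\<phi> ` e) = g (\<phi> ` e')"
      then have "\<phi> ` e = \<phi> ` e'" using inj_g pS by (meson inj_onD)
      then show "e = e'" using inj_on_image_eq_iff[OF inj] F(2) e by blast
    qed
    show "(\<lambda>e. g (\<phi> ` e)) ` hedges F \<subseteq> E" using g pS by blast
    show "\<phi> ` e \<subseteq> g (\<phi> ` e)" if "e \<in> hedges F" for e using g pS that by blast
  qed
qed

section \<open>Degrees and size of Berge-free extensions\<close>

lemma card_blocks_le:
  assumes "J \<subseteq> I" "finite J"
  shows "card (rest \<union> (\<Union>j\<in>J. B j)) \<le> card rest + card J * (r - 1)"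
proof -
  have "card (rest \<union> (\<Union>j\<in>J. B j)) \<le> card rest + card (\<Union>j\<in>J. B j)"
    by (rule card_Un_le)
  also have "card (\<Union>j\<in>J. B j) \<le> (\<Sum>j\<in>J. card (B j))" by (rule card_UN_le[OF assms(2)])
  also have "\<dots> = card J * (r - 1)" using B assms by (simp add: subset_iff)
  finally show ?thesis by simp
qed

lemma exists_star:
  assumes D: "D \<subseteq> Pow V" "t + 2 ^ (card rest + t * (r - 1)) < card D"
    and j0: "j0 \<in> I" and i: "i < t"
  shows "\<exists>J w h. finite J \<and> J \<subseteq> I - {j0} \<and> card J = i \<and> inj_on h J \<and>
           (\<forall>j\<in>J. h j \<in> D \<and> w j \<in> h j \<and> w j \<in> B j)"
  using i
proof (induction i)
  case 0
  show ?case by (intro exI[of _ "{}"]) auto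
next
  case (Suc i)
  from Suc.IH[OF Suc_lessD[OF Suc.prems]] obtain J w h where
    J: "finite J" "J \<subseteq> I - {j0}" "card J = i" "inj_on h J"
    "\<forall>j\<in>J. h j \<in> D \<and> w j \<in> h j \<and> w j \<in> B j" by blast
  \<comment> \<open>With \<open>j0\<close> included, at most \<open>Suc i\<close> blocks are
    forbidden, which is still below \<open>t\<close>.\<close>
  let ?X = "rest \<union> (\<Union>j\<in>insert j0 J. B j)"
  have X: "?X \<subseteq> V" using B J j0 unfolding rest_def by blast
  then have finX: "finite ?X" using fin_V finite_subset by blast
  have "card ?X \<le> card rest + card (insert j0 J) * (r - 1)"
    using card_blocks_le[of "insert j0 J"] J j0 by auto
  also have "card (insert j0 J) \<le> t" using J Suc.prems by (simp add: card_insert_if)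
  finally have "card ?X \<le> card rest + t * (r - 1)" by simp
  then have "card (Pow ?X) \<le> 2 ^ (card rest + t * (r - 1))"
    using finX by (simp add: card_Pow)
  moreover have "card (h ` J) \<le> t" using J Suc.prems by (simp add: card_image)
  moreover have "card (h ` J \<union> Pow ?X) \<le> card (h ` J) + card (Pow ?X)" by (rule card_Un_le)
  ultimately have "card (h ` J \<union> Pow ?X) < card D" using D by linarith
  then have "\<not> D \<subseteq> h ` J \<union> Pow ?X"
    using card_mono[of "h ` J \<union> Pow ?X" D] finX J(1) by auto
  then obtain e where e: "e \<in> D" "e \<notin> h ` J" "\<not> e \<subseteq> ?X" by blast
  then obtain x where x: "x \<in> e" "x \<notin> ?X" by blast
  then have "x \<in> V" using e D by blast
  then obtain j where j: "j \<in> I" "x \<in> B j" using x unfolding rest_def by blast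
  then have jJ: "j \<notin> J" "j \<noteq> j0" using x by auto
  have "inj_on (h(j := e)) (insert j J)"
    using J(4) jJ e by (auto simp: inj_on_def)
  moreover have "\<forall>i\<in>insert j J. (h(j := e)) i \<in> D \<and> (w(j := x)) i \<in> (h(j := e)) i \<and> (w(j := x)) i \<in> B i"
    using J(5) jJ e x j by auto
  moreover have "finite (insert j J)" "insert j J \<subseteq> I - {j0}" "card (insert j J) = Suc i"
    using J(1-3) jJ j by auto
  ultimately show ?case by blast
qed

text \<open>Base hyperedges contribute at most \<open>card C\<close> to the degree. If too many
  others contain \<open>v\<close>, \<open>exists_star\<close> finds \<open>card L\<close> leaves in
  distinct blocks away from that of \<open>v\<close>, and \<open>star_berge_copy\<close>
  applies.\<close>

lemma extension_degree:
  assumes E: "base \<subseteq> E" "E \<subseteq> Pow V" "berge_free F (V, E)"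
    and F: "finite (verts F)" "\<And>e. e \<in> hedges F \<Longrightarrow> e \<subseteq> verts F \<and> card e = 2"
    and L: "L \<subseteq> verts F" "\<And>e. e \<in> hedges F \<Longrightarrow> \<not> e \<subseteq> L" "card (verts F - L) = Suc (card C)"
    and v: "v \<in> V - rest"
  defines "t \<equiv> Suc (card L)"
  shows "card {e \<in> E. v \<in> e} \<le> card C + (t + 2 ^ (card rest + t * (r - 1)))"
proof (rule ccontr)
  assume large: "\<not> ?thesis"
  let ?D = "{e \<in> E - base. v \<in> e}"
  obtain j0 where j0: "j0 \<in> I" "v \<in> B j0" using v unfolding rest_def by blast
  have "v \<notin> C" using B j0 by blast
  then have "card {e \<in> base. v \<in> e} \<le> card C" by (rule base_degree)
  moreover have "{e \<in> E. v \<in> e} = {e \<in> base. v \<in> e} \<union> ?D" using E by blast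
  then have "card {e \<in> E. v \<in> e} \<le> card {e \<in> base. v \<in> e} + card ?D"
    by (metis (no_types, lifting) card_Un_le)
  ultimately have D: "t + 2 ^ (card rest + t * (r - 1)) < card ?D" using large by linarith
  have "?D \<subseteq> Pow V" using E by blast
  \<comment> \<open>The number of leaves is \<open>card L\<close>, strictly below
    \<open>t = Suc (card L)\<close>.\<close>
  from exists_star[OF this D[unfolded t_def] j0(1) lessI] obtain J w h where
    J: "finite J" "J \<subseteq> I - {j0}" "card J = card L" "inj_on h J"
    "\<forall>j\<in>J. h j \<in> ?D \<and> w j \<in> h j \<and> w j \<in> B j" by blast
  have disj: "i = j" if "i \<in> I" "j \<in> I" "x \<in> B i" "x \<in> B j" for i j x
    using disj_B that unfolding disjoint_family_on_def by blast
  have inj_w: "inj_on w J" using J disj by (intro inj_onI) (metis Diff_iff subset_iff)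
  have vW: "v \<notin> w ` J" using J disj j0 by blast
  have "\<not> berge_free F (V, E)"
  proof (rule star_berge_copy[OF E(1,2) F L vW, where h = "\<lambda>x. h (inv_into J w x)"])
    show "card (w ` J) = card L" "finite (w ` J)" using J inj_w by (auto simp: card_image)
    show "inj_on (\<lambda>x. h (inv_into J w x)) (w ` J)"
      using J(4) inj_w by (auto simp: inj_on_def)
    show "h (inv_into J w x) \<in> E - base \<and> v \<in> h (inv_into J w x) \<and> x \<in> h (inv_into J w x)"
      if "x \<in> w ` J" for x using that J(5) inj_w by auto
    show "\<exists>j\<in>I. B j \<inter> insert v (w ` J) = {x}" if x: "x \<in> insert v (w ` J)" for x
    proof (cases "x = v")
      case True
      have "B j0 \<inter> insert v (w ` J) = {x}" using True j0 J(2,5) disj by blast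
      then show ?thesis using j0 by blast
    next
      case False
      then obtain j where j: "j \<in> J" "x = w j" using x by blast
      have "B j \<inter> insert v (w ` J) = {x}"
      proof
        show "B j \<inter> insert v (w ` J) \<subseteq> {x}"
        proof
          fix y assume y: "y \<in> B j \<inter> insert v (w ` J)"
          show "y \<in> {x}"
          proof (cases "y = v")
            case True
            then show ?thesis using y j j0 J(2) disj[of j j0 v] by auto
          next
            case False
            then obtain i where "i \<in> J" "y = w i" using y by blast
            then show ?thesis using y j J(2,5) disj[of i j y] by auto
          qed
        qed
        show "{x} \<subseteq> B j \<inter> insert v (w ` J)" using j J(5) by auto
      qed
      then show ?thesis using j J(2) by blast
    qed
  qed
  then show False using E by blast
qed

text \<open>Summing the degree bound gives a bound linear in \<open>card V\<close>. Replacing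
  \<open>card rest\<close> by \<open>M\<close> makes the constants independent of the particular
  configuration.\<close>

lemma extension_card:
  assumes E: "base \<subseteq> E" "E \<subseteq> Pow V" "berge_free F (V, E)"
    and F: "finite (verts F)" "\<And>e. e \<in> hedges F \<Longrightarrow> e \<subseteq> verts F \<and> card e = 2"
    and L: "L \<subseteq> verts F" "\<And>e. e \<in> hedges F \<Longrightarrow> \<not> e \<subseteq> L" "card (verts F - L) = Suc (card C)"
    and M: "card rest \<le> M"
  defines "t \<equiv> Suc (card L)"
  shows "card E \<le> 2 ^ M + card V * (card C + (t + 2 ^ (M + t * (r - 1))))"
proof -
  let ?K = "card C + (t + 2 ^ (M + t * (r - 1)))"
  have fin_rest: "finite rest" unfolding rest_def using fin_V by simp
  have finE: "finite E" using E(2) fin_V finite_subset by blast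
  \<comment> \<open>A hyperedge either lies inside \<open>rest\<close> or contains a vertex of some
    block.\<close>
  have "E \<subseteq> Pow rest \<union> (\<Union>v\<in>V - rest. {e \<in> E. v \<in> e})" using E(2) by blast
  then have "card E \<le> card (Pow rest \<union> (\<Union>v\<in>V - rest. {e \<in> E. v \<in> e}))"
    using fin_V finE fin_rest by (intro card_mono) auto
  also have "\<dots> \<le> card (Pow rest) + card (\<Union>v\<in>V - rest. {e \<in> E. v \<in> e})" by (rule card_Un_le)
  also have "card (Pow rest) \<le> 2 ^ M" using M fin_rest by (simp add: card_Pow)
  also have "card (\<Union>v\<in>V - rest. {e \<in> E. v \<in> e}) \<le> (\<Sum>v\<in>V - rest. card {e \<in> E. v \<in> e})"
    using fin_V by (intro card_UN_le) simp
  also have "\<dots> \<le> (\<Sum>v\<in>V - rest. ?K)"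
  proof (rule sum_mono)
    fix v assume "v \<in> V - rest"
    from extension_degree[OF E F L this]
    have "card {e \<in> E. v \<in> e} \<le> card C + (t + 2 ^ (card rest + t * (r - 1)))"
      unfolding t_def by blast
    also have "(2::nat) ^ (card rest + t * (r - 1)) \<le> 2 ^ (M + t * (r - 1))"
      using M by (intro power_increasing) auto
    finally show "card {e \<in> E. v \<in> e} \<le> ?K" by simp
  qed
  also have "\<dots> \<le> card V * ?K"
    using fin_V by (auto intro!: mult_right_mono card_mono)
  finally show ?thesis by simp
qed

end

section \<open>Existence of the configuration and the linear bound\<close>

text \<open>Choose the core, then the private sets, then as many blocks as fit. The leftover is a
  remainder modulo \<open>r - 1\<close>, so the bound on \<open>rest\<close> does not grow with
  \<open>card V\<close>.\<close>

lemma core_blocks_exist: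
  fixes V :: "'a set"
  assumes r: "r \<ge> 2" and V: "finite V" and m: "m \<ge> 1"
    and n: "m + (m choose 2) * (r - 2) \<le> card V"
  obtains C P I B where "core_blocks r V C P I B" "card C = m"
    "card (core_blocks.rest V I B) \<le> m + (m choose 2) * (r - 2) + (r - 1)"
proof -
  obtain C where C: "C \<subseteq> V" "card C = m" "finite C"
    using obtain_subset_with_card_n[of m V] n by auto
  let ?pairs = "{p. p \<subseteq> C \<and> card p = 2}"
  have cp: "card ?pairs = m choose 2" using n_subsets[OF C(3)] C(2) by simp
  have fp: "finite ?pairs" using C by simp
  have "card (V - C) = card V - m" using C by (simp add: card_Diff_subset)
  then have "card ?pairs * (r - 2) \<le> card (V - C)" using n unfolding cp by simp
  from obtain_disjoint_subsets[OF fp finite_Diff[OF V] this]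
  obtain P where P: "disjoint_family_on P ?pairs"
    "\<And>p. p \<in> ?pairs \<Longrightarrow> P p \<subseteq> V - C \<and> card (P p) = r - 2"
    by blast
  define U where "U = (\<Union>p\<in>?pairs. P p)"
  define V' where "V' = V - C - U"
  have "card U \<le> (\<Sum>p\<in>?pairs. card (P p))" unfolding U_def by (rule card_UN_le[OF fp])
  also have "\<dots> = (m choose 2) * (r - 2)" using P(2) cp by simp
  finally have cU: "card U \<le> (m choose 2) * (r - 2)" .
  define q where "q = card V' div (r - 1)"
  have fV': "finite V'" using V unfolding V'_def by simp
  have "card {..<q} * (r - 1) \<le> card V'" unfolding q_def by simp
  then obtain B where B: "disjoint_family_on B {..<q}"
    "\<And>j. j \<in> {..<q} \<Longrightarrow> B j \<subseteq> V' \<and> card (B j) = r - 1"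
    using obtain_disjoint_subsets[OF _ fV', of "{..<q}" "r - 1"] by auto
  have cb: "core_blocks r V C P {..<q} B"
  proof
    show "C \<noteq> {}" using C m by auto
    show "P p \<inter> B j = {}" if "p \<subseteq> C" "card p = 2" "j \<in> {..<q}" for p j
      using B(2)[OF that(3)] that unfolding V'_def U_def by blast
    show "B j \<subseteq> V - C \<and> card (B j) = r - 1" if "j \<in> {..<q}" for j
      using B(2)[OF that] unfolding V'_def by blast
  qed (use r V C P B in auto)
  let ?Y = "\<Union>j<q. B j"
  have YV: "?Y \<subseteq> V'" using B(2) by blast
  have fB: "finite (B j)" if "j < q" for j
    using B(2)[of j] that fV' by (auto intro: finite_subset)
  have "card ?Y = (\<Sum>j<q. card (B j))"
    using B(1) fB by (intro card_UN_disjoint) (auto simp: disjoint_family_on_def)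
  also have "\<dots> = q * (r - 1)" using B(2) by simp
  finally have "card (V' - ?Y) = card V' - q * (r - 1)"
    using YV fV' by (simp add: card_Diff_subset finite_subset)
  also have "\<dots> = card V' mod (r - 1)" unfolding q_def by (simp add: minus_div_mult_eq_mod)
  also have "\<dots> \<le> r - 1" using r by (simp add: less_imp_le)
  finally have cW: "card (V' - ?Y) \<le> r - 1" .
  have fU: "finite U" unfolding U_def
    using P(2) V fp by (intro finite_UN_I) (auto intro: finite_subset[of _ V])
  have "core_blocks.rest V {..<q} B \<subseteq> C \<union> U \<union> (V' - ?Y)"
    unfolding core_blocks.rest_def[OF cb] V'_def by blast
  then have "card (core_blocks.rest V {..<q} B) \<le> card (C \<union> U \<union> (V' - ?Y))"
    using C fU fV' by (intro card_mono) auto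
  also have "\<dots> \<le> card C + card U + card (V' - ?Y)"
    using card_Un_le[of "C \<union> U" "V' - ?Y"] card_Un_le[of C U] by linarith
  also have "\<dots> \<le> m + (m choose 2) * (r - 2) + (r - 1)" using C cU cW by simp
  finally show ?thesis using that cb C by blast
qed

text \<open>The argument needs only an independent set \<open>L\<close> in \<open>F\<close> such
  that all degrees are at least the number of vertices outside \<open>L\<close>, and that number is
  at least 2.\<close>

lemma sat_linear:
  assumes r: "r \<ge> 2"
    and F: "finite (verts F)" "\<And>e. e \<in> hedges F \<Longrightarrow> e \<subseteq> verts F \<and> card e = 2"
    and L: "L \<subseteq> verts F" "\<And>e. e \<in> hedges F \<Longrightarrow> \<not> e \<subseteq> L" "card (verts F - L) \<ge> 2"
    and deg: "\<And>u. u \<in> verts F \<Longrightarrow> card (verts F - L) \<le> card {e \<in> hedges F. u \<in> e}"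
  shows "(\<lambda>n. real (sat r n F)) \<in> O(\<lambda>n. real n)"
proof -
  \<comment> \<open>The core has one vertex fewer than the complement of \<open>L\<close>: all
    degrees of \<open>F\<close> then exceed \<open>m\<close>, and the centre of a star supplies the
    missing vertex.\<close>
  define m where "m = card (verts F - L) - 1"
  have m: "m \<ge> 1" "card (verts F - L) = Suc m" using L(3) unfolding m_def by auto
  define t where "t = Suc (card L)"
  define M where "M = m + (m choose 2) * (r - 2) + (r - 1)"
  define K where "K = m + (t + 2 ^ (M + t * (r - 1)))"
  have bound: "sat r n F \<le> 2 ^ M + n * K" if n: "n \<ge> M" for n
  proof -
    have "m + (m choose 2) * (r - 2) \<le> card {..<n}" using n unfolding M_def by simp
    from core_blocks_exist[OF r finite_lessThan m(1) this]
    obtain C P I B where cb: "core_blocks r {..<n} C P I B" and card_C: "card C = m"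
      and rest: "card (core_blocks.rest {..<n} I B) \<le> M"
      unfolding M_def by blast
    interpret core_blocks r "{..<n}" C P I B by (rule cb)
    show ?thesis
    proof (rule sat_le[where V = "{..<n}" and ?E0.0 = base])
      have "card (verts F - L) \<le> card (verts F)" using F by (intro card_mono) auto
      then show "berge_free F ({..<n}, base)"
        using m deg by (intro base_berge_free) (simp_all add: card_C Suc_le_eq)
      fix E assume E: "base \<subseteq> E" "E \<subseteq> {e. e \<subseteq> {..<n} \<and> card e = r}" "berge_free F ({..<n}, E)"
      then have "E \<subseteq> Pow {..<n}" by blast
      from extension_card[OF E(1) this E(3) F L(1,2) _ rest] m card_C
      show "card E \<le> 2 ^ M + n * K" unfolding K_def t_def by simp
    qed (use base_uniform in auto)
  qed
  \<comment> \<open>Taking \<open>Suc M\<close> ensures \<open>n \<ge> 1\<close>, which lets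
    \<open>2 ^ M\<close> be absorbed into \<open>2 ^ M * n\<close>.\<close>
  have "sat r n F \<le> (2 ^ M + K) * n" if "n \<ge> Suc M" for n
  proof -
    have "sat r n F \<le> 2 ^ M + n * K" using bound that by simp
    also have "\<dots> \<le> 2 ^ M * n + n * K" using that by simp
    finally show ?thesis by (simp add: algebra_simps)
  qed
  then have "real (sat r n F) \<le> real (2 ^ M + K) * real n" if "n \<ge> Suc M" for n
    using that by (metis of_nat_le_iff of_nat_mult)
  then show ?thesis
    by (intro bigoI[where c = "real (2 ^ M + K)"] eventually_sequentiallyI[of "Suc M"]) simp
qed

section \<open>Application to complete multipartite graphs\<close>

theorem theorem1p2:
  fixes r s :: nat and k :: "nat \<Rightarrow> nat"
  assumes "r \<ge> 2" and "s \<ge> 2"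
    and "1 \<le> k 1" and "\<forall>i\<in>{1..s}. k i \<le> k (i + 1)"
  shows "(\<lambda>n. real (sat r n (complete_multipartite (s + 1) k))) \<in> O(\<lambda>n. real n)"
proof -
  let ?F = "complete_multipartite (s + 1) k"
  define V where "V = (SIGMA i:{1..s+1}. {..<k i})"
  \<comment> \<open>The last class, which is a largest one.\<close>
  define L where "L = {s+1} \<times> {..<k (s+1)}"
  have vF: "verts ?F = V"
    and eF: "hedges ?F = {{u, w} | u w. u \<in> V \<and> w \<in> V \<and> fst u \<noteq> fst w}"
    unfolding complete_multipartite_def V_def Let_def by auto
  have finV: "finite V" unfolding V_def by auto
  have LV: "L \<subseteq> V" unfolding L_def V_def by auto
  have mono: "k i \<le> k j" if "1 \<le> i" "i \<le> j" "j \<le> s + 1" for i j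
    using that(2,3,1)
  proof (induction j rule: dec_induct)
    case (step j)
    then have "k j \<le> k (j + 1)" using assms(4) by auto
    then show ?case using step by simp
  qed simp
  \<comment> \<open>A vertex is adjacent to everything outside its own class, and that class is no
    larger than \<open>L\<close>.\<close>
  have deg: "card (V - L) \<le> card {e \<in> hedges ?F. u \<in> e}" if u: "u \<in> V" for u
  proof -
    let ?N = "{w \<in> V. fst w \<noteq> fst u}" and ?S = "{fst u} \<times> {..<k (fst u)}"
    have SV: "?S \<subseteq> V" and i: "1 \<le> fst u" "fst u \<le> s + 1" using u unfolding V_def by auto
    have N: "?N = V - ?S" unfolding V_def by auto
    have "card ?N = card V - k (fst u)"
      unfolding N using SV by (simp add: card_Diff_subset card_cartesian_product)
    moreover have "card (V - L) = card V - k (s+1)"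
      using LV unfolding L_def by (simp add: card_Diff_subset card_cartesian_product)
    ultimately have "card (V - L) \<le> card ?N" using mono[OF i] by simp
    also have "\<dots> = card ((\<lambda>w. {u, w}) ` ?N)"
      by (intro card_image[symmetric]) (auto simp: inj_on_def doubleton_eq_iff)
    also have "\<dots> \<le> card {e \<in> hedges ?F. u \<in> e}"
    proof (rule card_mono)
      have "hedges ?F \<subseteq> Pow V" unfolding eF by auto
      then show "finite {e \<in> hedges ?F. u \<in> e}"
        using finV by (auto intro: finite_subset[of _ "Pow V"])
      have "{u, w} \<in> hedges ?F" if "w \<in> ?N" for w
        unfolding eF using u that by (intro CollectI exI[of _ u] exI[of _ w]) auto
      then show "(\<lambda>w. {u, w}) ` ?N \<subseteq> {e \<in> hedges ?F. u \<in> e}" by blast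
    qed
    finally show ?thesis .
  qed
  \<comment> \<open>As \<open>s \<ge> 2\<close>, the first two classes differ from the last one, and
    both are nonempty; this makes the core nonempty.\<close>
  have "{(1, 0), (2, 0)} \<subseteq> V - L"
    using assms(2,3) mono[of 1 2] unfolding V_def L_def by auto
  then have "card {(1::nat, 0::nat), (2, 0)} \<le> card (V - L)"
    using finV by (intro card_mono) auto
  then have two: "2 \<le> card (V - L)" by simp
  show ?thesis
  proof (rule sat_linear[OF assms(1), where F = ?F and L = L, unfolded vF])
    show "e \<subseteq> V \<and> card e = 2" if "e \<in> hedges ?F" for e
      using that unfolding eF by (auto simp: card_insert_if)
    show "\<not> e \<subseteq> L" if "e \<in> hedges ?F" for e
      using that unfolding eF L_def by auto
  qed (use finV LV deg two in auto)
qed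

end
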